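(* Let $f:\mathbb{R}\to\mathbb{R}$ be positive on every prime. Suppose there exist a positive integer $\alpha$ and a real constant $M\ge 0$ such that for every prime $p$, $$0 \le \frac{1}{f(p)} - \frac{\alpha}{p} \le \frac{M}{p^2}.$$ Then there is a nonnegative constant $\beta_f$ (depending on $f$) such that, as $n\to\infty$, $$\log n!_f = \log (\alpha n)! + \beta_f n + o(n).$$
   Context: $\mathbb{P}$ is the set of primes, $\log$ the natural logarithm, $\lfloor\cdot\rfloor$ the floor function. For $f:\mathbb{R}\to\mathbb{R}$ positive on $\mathbb{P}$, the $f$-factorial is $n!_f=\prod_{p\in\mathbb{P}} p^{\sum_{k\ge 0}\lfloor n/(f(p)p^k)\rfloor}$. *)

theory Defs
  imports "HOL-Analysis.Infinite_Products" "HOL-Library.Landau_Symbols"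
    "HOL-Computational_Algebra.Primes"
begin

text \<open>
  The exponent of \<open>p\<close> is a series of natural numbers; if \<open>f p > 0\<close>, only finitely many of its
  terms are nonzero and all the floors are nonnegative, so \<open>nat\<close> loses nothing.
\<close>
definition ffact_exponent :: "(real \<Rightarrow> real) \<Rightarrow> nat \<Rightarrow> nat \<Rightarrow> nat" where
  "ffact_exponent f n p = (\<Sum>k. nat \<lfloor>real n / (f (real p) * real p ^ k)\<rfloor>)"

text \<open>
  The product over all primes is an infinite product in which non-primes contribute the factor
  \<open>1\<close>. If \<open>1 / f p\<close> tends to \<open>0\<close> along the primes, all but finitely many factors are \<open>1\<close>.
\<close>
definition ffact :: "(real \<Rightarrow> real) \<Rightarrow> nat \<Rightarrow> real" where
  "ffact f n = (\<Prod>p. if prime p then real p ^ ffact_exponent f n p else 1)"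

lemma ffact_exponent_finite:
  assumes "f (real p) > 0" "prime p"
  shows "finite {k. nat \<lfloor>real n / (f (real p) * real p ^ k)\<rfloor> \<noteq> 0}"
proof -
  have p: "real p > 1" using prime_gt_1_nat[OF assms(2)] by simp
  obtain N where N: "real n / f (real p) < real p ^ N"
    using real_arch_pow[OF p] by blast
  have "nat \<lfloor>real n / (f (real p) * real p ^ k)\<rfloor> = 0" if "k \<ge> N" for k
  proof -
    have "real p ^ N \<le> real p ^ k" using that p by (intro power_increasing) auto
    with N have "real n / f (real p) < real p ^ k" by linarith
    hence "real n / (f (real p) * real p ^ k) < 1" using assms p by (simp add: field_simps)
    thus ?thesis by linarith
  qed
  hence "{k. nat \<lfloor>real n / (f (real p) * real p ^ k)\<rfloor> \<noteq> 0} \<subseteq> {..<N}"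
    by (auto simp: not_less[symmetric])
  thus ?thesis using finite_subset by blast
qed

lemma ffact_exponent_eq_0:
  assumes "f (real p) > real n" "prime p"
  shows "ffact_exponent f n p = 0"
proof -
  have "nat \<lfloor>real n / (f (real p) * real p ^ k)\<rfloor> = 0" for k
  proof -
    have "f (real p) * 1 \<le> f (real p) * real p ^ k"
      using assms prime_ge_1_nat[OF assms(2)] by (intro mult_left_mono one_le_power) auto
    hence "real n / (f (real p) * real p ^ k) < 1"
      using assms by (subst divide_less_eq_1_pos) linarith+
    thus ?thesis by linarith
  qed
  thus ?thesis by (simp add: ffact_exponent_def)
qed

lemma ffact_eq_finite_prod:
  assumes "finite A" "\<And>p. p \<in> A \<Longrightarrow> prime p"
    and "\<And>p. prime p \<Longrightarrow> p \<notin> A \<Longrightarrow> f (real p) > real n"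
  shows "ffact f n = (\<Prod>p\<in>A. real p ^ ffact_exponent f n p)"
proof -
  have "ffact f n = (\<Prod>p\<in>A. if prime p then real p ^ ffact_exponent f n p else 1)"
    unfolding ffact_def using assms ffact_exponent_eq_0
    by (intro prodinf_finite) auto
  also have "\<dots> = (\<Prod>p\<in>A. real p ^ ffact_exponent f n p)"
    using assms(2) by (intro prod.cong) auto
  finally show ?thesis .
qed

end

theory Submission
  imports Defs "HOL-Analysis.Summation_Tests" "HOL-Real_Asymp.Real_Asymp"
begin

text \<open>
  Write \<open>\<delta> p = 1 / f p - \<alpha> / p\<close>. By Legendre's formula, \<open>log n!\<^sub>f - log (\<alpha> n)!\<close> is the sum over
  \<open>p\<close> and \<open>k\<close> of \<open>log p\<close> times the difference of the floors of two numbers at distance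
  \<open>n \<delta> p / p\<^sup>k\<close>. Let \<open>C = \<alpha> + M\<close>. For \<open>p\<^sup>2 \<le> C n\<close> dropping the floors costs \<open>O(log n)\<close> per
  prime, hence \<open>O(sqrt n (log n)\<^sup>2)\<close> in total, and leaves a partial sum of the convergent series
  \<open>\<beta> = (\<Sum>p. log p * \<delta> p * p / (p - 1))\<close>. For \<open>p\<^sup>2 > C n\<close> only \<open>k = 0\<close> contributes, and
  counting the integers between the two numbers as pairs \<open>(m, p)\<close> by \<open>m\<close> instead of by \<open>p\<close> gives
  a bound \<open>O(sqrt n log n)\<close>.
\<close>

section \<open>Legendre's formula and its analogue for the exponents of the f-factorial\<close>

text \<open>\<open>p ^ Suc k\<close> divides \<open>m\<close> exactly for the \<open>k\<close> below
  the multiplicity, and \<open>2 ^ multiplicity p m \<le> m < 2 ^ N\<close> keeps these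
  \<open>k\<close> below \<open>N\<close>. Bounding by powers of 2 gives a range of summation common
  to all primes.\<close>

lemma multiplicity_eq_sum_dvd:
  fixes p m :: nat
  assumes "prime p" "m > 0" "m < 2 ^ N"
  shows "multiplicity p m = (\<Sum>k<N. of_bool (p ^ Suc k dvd m))"
proof -
  have p: "p \<ge> 2" using assms(1) prime_ge_2_nat by blast
  have iff: "p ^ Suc k dvd m \<longleftrightarrow> k < multiplicity p m" for k
    using assms p by (subst power_dvd_iff_le_multiplicity) (auto simp: Suc_le_eq)
  have "p ^ multiplicity p m \<le> m"
    using assms multiplicity_dvd by (intro dvd_imp_le) auto
  moreover have "(2::nat) ^ multiplicity p m \<le> p ^ multiplicity p m"
    using p by (intro power_mono) auto
  ultimately have "(2::nat) ^ multiplicity p m < 2 ^ N" using assms(3) by linarith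
  hence le: "multiplicity p m < N" by simp
  have "(\<Sum>k<N. of_bool (p ^ Suc k dvd m)) = card {k\<in>{..<N}. k < multiplicity p m}"
    unfolding iff by (simp add: Int_def)
  also have "{k\<in>{..<N}. k < multiplicity p m} = {..<multiplicity p m}" using le by auto
  finally show ?thesis by simp
qed

text \<open>This is the logarithm of the prime factorization, padded with zero terms for the primes
  of \<open>A\<close> that do not divide \<open>m\<close>. The padding lets one set \<open>A\<close>
  serve every \<open>m\<close> in the induction for Legendre's formula.\<close>

lemma ln_nat_eq_sum_multiplicity:
  fixes m :: nat
  assumes "finite A" "\<And>p. p \<in> A \<Longrightarrow> prime p" "\<And>p. prime p \<Longrightarrow> p \<le> m \<Longrightarrow> p \<in> A" "m > 0"
  shows "ln (real m) = (\<Sum>p\<in>A. ln (real p) * real (multiplicity p m))"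
proof -
  have "real m = real (\<Prod>p\<in>prime_factors m. p ^ multiplicity p m)"
    using assms(4) by (subst prime_factorization_nat[symmetric]) auto
  hence "ln (real m) = ln (\<Prod>p\<in>prime_factors m. real p ^ multiplicity p m)" by simp
  also have "\<dots> = (\<Sum>p\<in>prime_factors m. ln (real p ^ multiplicity p m))"
    by (subst ln_prod) (auto simp: in_prime_factors_iff prime_gt_0_nat)
  also have "\<dots> = (\<Sum>p\<in>prime_factors m. ln (real p) * real (multiplicity p m))"
    by (intro sum.cong) (auto simp: ln_realpow in_prime_factors_iff prime_gt_0_nat mult.commute)
  also have "\<dots> = (\<Sum>p\<in>A. ln (real p) * real (multiplicity p m))"
  proof (rule sum.mono_neutral_left)
    show "prime_factors m \<subseteq> A"
      using assms(3,4) by (auto simp: in_prime_factors_iff dest: dvd_imp_le)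
    show "\<forall>p\<in>A - prime_factors m. ln (real p) * real (multiplicity p m) = 0"
      using assms(2,4) by (auto simp: in_prime_factors_iff not_dvd_imp_multiplicity_0)
  qed (use assms in auto)
  finally show ?thesis .
qed

text \<open>Induction on \<open>m\<close>: the quotient by \<open>p ^ Suc k\<close> grows by 1
  exactly when \<open>p ^ Suc k\<close> divides \<open>Suc m\<close>, so the inner sum grows by the
  multiplicity of \<open>p\<close> in \<open>Suc m\<close>. Weighted with \<open>ln p\<close>, these
  increments add up to \<open>ln (Suc m)\<close>.\<close>

lemma ln_fact_legendre:
  fixes m :: nat
  assumes "finite A" "\<And>p. p \<in> A \<Longrightarrow> prime p" "\<And>p. prime p \<Longrightarrow> p \<le> m \<Longrightarrow> p \<in> A" "m < 2 ^ N"
  shows "ln (fact m) = (\<Sum>p\<in>A. ln (real p) * (\<Sum>k<N. real (m div p ^ Suc k)))"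
  using assms(3,4)
proof (induction m)
  case 0
  thus ?case by simp
next
  case (Suc m)
  have step: "(\<Sum>k<N. real (Suc m div p ^ Suc k)) =
               real (multiplicity p (Suc m)) + (\<Sum>k<N. real (m div p ^ Suc k))"
    if "p \<in> A" for p
  proof -
    have "(\<Sum>k<N. real (Suc m div p ^ Suc k)) =
          (\<Sum>k<N. real (of_bool (p ^ Suc k dvd Suc m)) + real (m div p ^ Suc k))"
      by (intro sum.cong) (auto simp: div_Suc dvd_eq_mod_eq_0 simp del: power_Suc)
    thus ?thesis
      using multiplicity_eq_sum_dvd[of p "Suc m" N] assms(2)[OF that] Suc.prems
      by (simp add: sum.distrib del: power_Suc)
  qed
  have "ln (fact (Suc m) :: real) = ln (real (Suc m)) + ln (fact m)"
    by (simp add: ln_mult del: of_nat_Suc)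
  also have "ln (fact m) = (\<Sum>p\<in>A. ln (real p) * (\<Sum>k<N. real (m div p ^ Suc k)))"
    using Suc by auto
  also have "ln (real (Suc m)) = (\<Sum>p\<in>A. ln (real p) * real (multiplicity p (Suc m)))"
    by (rule ln_nat_eq_sum_multiplicity[OF assms(1,2) Suc.prems(1)]) simp_all
  finally show ?case
    by (simp add: step sum.distrib distrib_left del: power_Suc)
qed

text \<open>For \<open>k \<ge> N\<close> the quotient is below 1 because
  \<open>p ^ k \<ge> 2 ^ N\<close>, so its floor vanishes. The outcome is a real sum over the same
  range as in Legendre's formula, ready for termwise subtraction.\<close>

lemma ffact_exponent_eq_finite_sum:
  assumes "prime p" "f (real p) > 0" "real n / f (real p) < 2 ^ N"
  shows "real (ffact_exponent f n p) = (\<Sum>k<N. real_of_int \<lfloor>real n / f (real p) / real p ^ k\<rfloor>)"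
proof -
  have p: "real p \<ge> 2" using prime_ge_2_nat[OF assms(1)] by simp
  have z: "nat \<lfloor>real n / (f (real p) * real p ^ k)\<rfloor> = 0" if "k \<notin> {..<N}" for k
  proof -
    have "(2::real) ^ N \<le> 2 ^ k" using that by (intro power_increasing) auto
    also have "\<dots> \<le> real p ^ k" using p by (intro power_mono) auto
    finally have "real n / f (real p) < real p ^ k" using assms(3) by linarith
    hence "real n / (f (real p) * real p ^ k) < 1" using assms p by (simp add: field_simps)
    thus ?thesis by linarith
  qed
  have "ffact_exponent f n p = (\<Sum>k<N. nat \<lfloor>real n / (f (real p) * real p ^ k)\<rfloor>)"
    unfolding ffact_exponent_def by (rule suminf_finite) (use z in auto)
  hence "real (ffact_exponent f n p) =
          (\<Sum>k<N. real (nat \<lfloor>real n / (f (real p) * real p ^ k)\<rfloor>))" by simp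
  also have "\<dots> = (\<Sum>k<N. real_of_int \<lfloor>real n / f (real p) / real p ^ k\<rfloor>)"
    using assms p by (intro sum.cong) (auto simp: of_nat_nat)
  finally show ?thesis .
qed

section \<open>Integers in intervals, a convergent majorant, and the cost of dropping floors\<close>

text \<open>Serves both directions of the later double count: the exact value turns a difference of
  floors into a cardinality, and the upper bound limits the number of \<open>p\<close> for a given
  \<open>m\<close>.\<close>

lemma card_nat_Ioc_le:
  assumes "a \<ge> 0" "L \<ge> 0"
  shows "real (card {p::nat. a < real p \<and> real p \<le> a + L}) \<le> L + 1"
    and "finite {p::nat. a < real p \<and> real p \<le> a + L}"
    and "card {p::nat. a < real p \<and> real p \<le> a + L} = \<lfloor>a + L\<rfloor> - \<lfloor>a\<rfloor>"
proof -
  have eq: "{p::nat. a < real p \<and> real p \<le> a + L} = {nat \<lfloor>a\<rfloor><..nat \<lfloor>a + L\<rfloor>}"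
    using assms by (auto simp: le_nat_floor floor_less_iff nat_less_iff le_nat_iff le_floor_iff)
  show "finite {p::nat. a < real p \<and> real p \<le> a + L}" unfolding eq by simp
  show *: "card {p::nat. a < real p \<and> real p \<le> a + L} = \<lfloor>a + L\<rfloor> - \<lfloor>a\<rfloor>"
    unfolding eq using assms by (simp add: of_nat_diff nat_mono floor_mono)
  have "real (card {p::nat. a < real p \<and> real p \<le> a + L}) = real_of_int (\<lfloor>a + L\<rfloor> - \<lfloor>a\<rfloor>)"
    using arg_cong[OF *, of real_of_int] by simp
  thus "real (card {p::nat. a < real p \<and> real p \<le> a + L}) \<le> L + 1" by linarith
qed

text \<open>Majorant for the series defining \<open>\<beta>\<close>. The exponent -3/2 leaves a
  factor \<open>p powr (1/2)\<close> to absorb the logarithm.\<close>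

lemma summable_ln_over_square: "summable (\<lambda>p::nat. ln (real p) / (real p)\<^sup>2)"
proof (rule summable_comparison_test_bigo)
  show "summable (\<lambda>p. norm (real p powr (-3/2)))"
    using summable_real_powr_iff[of "-3/2"] by simp
  show "(\<lambda>p::nat. ln (real p) / (real p)\<^sup>2) \<in> O(\<lambda>p. real p powr (-3/2))"
    by real_asymp
qed

text \<open>Each of the \<open>N\<close> differences of floors is within 1 of
  \<open>d / p ^ k\<close>, which costs \<open>N\<close>. Completing the geometric series to
  \<open>d * p / (p - 1)\<close> adds a tail \<open>d / p ^ N * (p / (p - 1))\<close>, which is at
  most \<open>1 * 2\<close>.\<close>

lemma sum_floor_diff_approx:
  fixes x d :: real and p :: nat
  assumes "p \<ge> 2" "d \<ge> 0" "d \<le> 2 ^ N"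
  shows "\<bar>(\<Sum>k<N. real_of_int \<lfloor>(x + d) / real p ^ k\<rfloor> - real_of_int \<lfloor>x / real p ^ k\<rfloor>) -
           d * (real p / (real p - 1))\<bar> \<le> real N + 2"
proof -
  let ?F = "\<lambda>k. real_of_int \<lfloor>(x + d) / real p ^ k\<rfloor> - real_of_int \<lfloor>x / real p ^ k\<rfloor>"
  have p: "real p \<ge> 2" using assms by simp
  have gp: "(\<Sum>k<N. d / real p ^ k) =
      d * (real p / (real p - 1)) - d / real p ^ N * (real p / (real p - 1))"
  proof (induction N)
    case (Suc N)
    \<comment> \<open>The term is the difference of two consecutive tails of the geometric
      series.\<close>
    have "d / real p ^ N = (d / real p ^ N - d / real p ^ Suc N) * (real p / (real p - 1))"
      using p by (simp add: field_simps)
    thus ?case using Suc by (simp add: algebra_simps)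
  qed simp
  have "(2::real) ^ N \<le> real p ^ N" using p by (intro power_mono) auto
  hence "d / real p ^ N \<le> 1" using assms p by (simp add: field_simps)
  moreover have "real p / (real p - 1) \<le> 2" using p by (simp add: field_simps)
  ultimately have "d / real p ^ N * (real p / (real p - 1)) \<le> 1 * 2"
    using p assms by (intro mult_mono) auto
  moreover have "0 \<le> d / real p ^ N * (real p / (real p - 1))"
    using p assms by simp
  moreover have "\<bar>(\<Sum>k<N. ?F k) - (\<Sum>k<N. d / real p ^ k)\<bar> \<le> real N"
  proof -
    have "\<bar>?F k - d / real p ^ k\<bar> \<le> 1" for k
      by (simp only: add_divide_distrib) linarith
    hence "(\<Sum>k<N. \<bar>?F k - d / real p ^ k\<bar>) \<le> (\<Sum>k<N. 1)" by (intro sum_mono)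
    thus ?thesis
      unfolding sum_subtractf[symmetric] using sum_abs[of "\<lambda>k. ?F k - d / real p ^ k" "{..<N}"]
      by (simp add: sum_subtractf)
  qed
  ultimately show ?thesis using gp by linarith
qed


section \<open>The logarithm of the f-factorial as a finite sum\<close>

text \<open>If \<open>p > C * n\<close>, then \<open>f p \<ge> p / C > n\<close>, so the factor at
  \<open>p\<close> is 1 and the infinite product becomes finite. For the remaining primes
  \<open>n / f p \<le> C * n < 2 ^ N\<close>, so one \<open>N\<close> suffices for all
  exponents.\<close>

lemma ln_ffact_eq:
  assumes pos: "\<And>p::nat. prime p \<Longrightarrow> f (real p) > 0"
    and le: "\<And>p::nat. prime p \<Longrightarrow> 1 / f (real p) \<le> C / real p"
    and N: "C * real n < 2 ^ N" and C: "C > 0"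
  shows "ln (ffact f n) = (\<Sum>p | prime p \<and> real p \<le> C * real n.
           ln (real p) * (\<Sum>k<N. real_of_int \<lfloor>real n / f (real p) / real p ^ k\<rfloor>))"
proof -
  let ?A = "{p. prime p \<and> real p \<le> C * real n}"
  have "?A \<subseteq> {..nat \<lfloor>C * real n\<rfloor>}" by (auto simp: le_nat_floor)
  hence fin: "finite ?A" using finite_subset by blast
  have "ffact f n = (\<Prod>p\<in>?A. real p ^ ffact_exponent f n p)"
  proof (rule ffact_eq_finite_prod[OF fin])
    fix p :: nat assume p: "prime p" "p \<notin> ?A"
    hence "C * real n < real p" by simp
    also have "real p \<le> C * f (real p)"
      using pos[OF p(1)] le[OF p(1)] prime_gt_0_nat[OF p(1)] by (simp add: field_simps)
    finally show "f (real p) > real n" using C by simp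
  qed auto
  hence "ln (ffact f n) = (\<Sum>p\<in>?A. ln (real p ^ ffact_exponent f n p))"
    using fin by (simp, subst ln_prod) (auto simp: prime_gt_0_nat)
  also have "\<dots> = (\<Sum>p\<in>?A. ln (real p) *
                 (\<Sum>k<N. real_of_int \<lfloor>real n / f (real p) / real p ^ k\<rfloor>))"
  proof (rule sum.cong, rule refl)
    fix p assume "p \<in> ?A"
    hence p: "prime p" by simp
    have p1: "real p \<ge> 1" using prime_ge_1_nat[OF p] by simp
    have "real n / f (real p) = real n * (1 / f (real p))" by simp
    also have "\<dots> \<le> real n * (C / real p)" using le[OF p] by (intro mult_left_mono) auto
    also have "\<dots> = C * real n / real p" by simp
    also have "\<dots> \<le> C * real n / 1" using p1 C by (intro divide_left_mono) auto
    finally have "real n / f (real p) < 2 ^ N" using N by simp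
    thus "ln (real p ^ ffact_exponent f n p) =
          ln (real p) * (\<Sum>k<N. real_of_int \<lfloor>real n / f (real p) / real p ^ k\<rfloor>)"
      using ffact_exponent_eq_finite_sum[of p f n N] p pos[OF p] p1
      by (simp add: ln_realpow)
  qed
  finally show ?thesis .
qed

section \<open>Double counting for the large primes\<close>

text \<open>
  A contribution at \<open>p\<close> comes from an integer \<open>m\<close> with \<open>a n / p < m \<le> n g p\<close>. Such an \<open>m\<close> is at
  most \<open>sqrt ((a + M) n)\<close>, and given \<open>m\<close>, the number \<open>p\<close> lies in an interval of length \<open>M / a\<close>.
\<close>
lemma sum_floor_diff_large_le:
  fixes g :: "nat \<Rightarrow> real" and a M :: real and n :: nat
  assumes fin: "finite A" and a: "a > 0" and M: "M \<ge> 0"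
    and A: "\<And>p. p \<in> A \<Longrightarrow> p \<ge> 1 \<and> (a + M) * real n < (real p)\<^sup>2"
    and g: "\<And>p. p \<in> A \<Longrightarrow> a / real p \<le> g p \<and> g p \<le> a / real p + M / (real p)\<^sup>2"
  shows "(\<Sum>p\<in>A. real_of_int \<lfloor>real n * g p\<rfloor> - real_of_int \<lfloor>real n * (a / real p)\<rfloor>)
           \<le> (M / a + 1) * sqrt ((a + M) * real n)"
proof -
  define x where "x p = real n * (a / real p)" for p :: nat
  define d where "d p = real n * (g p - a / real p)" for p
  define S where "S p = {m::nat. x p < real m \<and> real m \<le> x p + d p}" for p
  define T where "T m = {p::nat. real n * a / real m < real p \<and>
                                 real p \<le> real n * a / real m + M / a}" for m :: nat
  define Y where "Y = nat \<lfloor>sqrt ((a + M) * real n)\<rfloor>"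
  have x0: "x p \<ge> 0" for p using a by (simp add: x_def)
  have d0: "d p \<ge> 0" if "p \<in> A" for p using g[OF that] by (simp add: d_def)
  have xd: "x p + d p = real n * g p" for p by (simp add: x_def d_def algebra_simps)
  have finS: "finite (S p)" if "p \<in> A" for p
    unfolding S_def by (rule card_nat_Ioc_le(2)[OF x0 d0[OF that]])
  have cardT: "real (card (T m)) \<le> M / a + 1" and finT: "finite (T m)" for m
    unfolding T_def using a M by (intro card_nat_Ioc_le; simp)+
  have "real_of_int \<lfloor>real n * g p\<rfloor> - real_of_int \<lfloor>real n * (a / real p)\<rfloor> = real (card (S p))"
    if "p \<in> A" for p
    using arg_cong[OF card_nat_Ioc_le(3)[OF x0 d0[OF that], of p], of real_of_int]
    unfolding xd S_def by (simp add: x_def)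
  hence "(\<Sum>p\<in>A. real_of_int \<lfloor>real n * g p\<rfloor> - real_of_int \<lfloor>real n * (a / real p)\<rfloor>) =
         real (card (Sigma A S))"
    using fin finS by (simp add: card_SigmaI)
  also have "card (Sigma A S) = card (prod.swap ` Sigma A S)"
    by (simp add: card_image)
  also have "\<dots> \<le> card (Sigma {1..Y} T)"
  proof (rule card_mono)
    show "finite (Sigma {1..Y} T)" using finT by auto
    show "prod.swap ` Sigma A S \<subseteq> Sigma {1..Y} T"
    proof clarsimp
      fix p m assume p: "p \<in> A" and m: "m \<in> S p"
      have p1: "real p \<ge> 1" using A[OF p] by simp
      have m1: "x p < real m" and m2: "real m \<le> real n * g p" using m xd by (auto simp: S_def)
      have m0: "real m > 0" using m1 x0[of p] by linarith
      have "real n * g p \<le> real n * (a / real p + M / (real p)\<^sup>2)"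
        using g[OF p] by (intro mult_left_mono) auto
      hence m3: "real m \<le> real n * (a / real p + M / (real p)\<^sup>2)" using m2 by linarith
      \<comment> \<open>Weakening \<open>M / p^2\<close> to \<open>M / p\<close> gives
        \<open>m \<le> (a + M) * n / p\<close>, and \<open>p\<close> is at least the square root of
        \<open>(a + M) * n\<close>.\<close>
      have "M / (real p)\<^sup>2 \<le> M / real p"
        using p1 M by (intro divide_left_mono) (auto simp: power2_eq_square)
      hence "real n * (a / real p + M / (real p)\<^sup>2) \<le> real n * (a / real p + M / real p)"
        by (intro mult_left_mono) auto
      also have "\<dots> = (a + M) * real n / real p" using p1 by (simp add: field_simps)
      also have "\<dots> \<le> sqrt ((a + M) * real n)"
      proof -
        have "sqrt ((a + M) * real n) \<le> real p"
          using A[OF p] by (intro real_le_lsqrt) auto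
        hence "sqrt ((a + M) * real n) * sqrt ((a + M) * real n) \<le>
               sqrt ((a + M) * real n) * real p"
          using a M by (intro mult_left_mono) auto
        thus ?thesis using p1 a M by (simp add: field_simps)
      qed
      finally have "real m \<le> sqrt ((a + M) * real n)" using m3 by linarith
      hence mY: "m \<le> Y" by (simp add: Y_def le_nat_floor)
      have lt: "real n * a < real m * real p" using m1 p1 by (simp add: x_def field_simps)
      have "real m * real p \<le> real n * (a / real p + M / (real p)\<^sup>2) * real p"
        using m3 p1 by (intro mult_right_mono) auto
      also have "\<dots> = real n * a + real n * a * (M / a / real p)"
        using p1 a by (simp add: field_simps power2_eq_square)
      \<comment> \<open>Only in the error term is \<open>n * a\<close> replaced by the larger
        \<open>m * p\<close>. This cancels \<open>p\<close> there and leaves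
        \<open>m * M / a\<close>, so that dividing by \<open>m\<close> gives the interval length
        \<open>M / a\<close>.\<close>
      also have "\<dots> \<le> real n * a + real m * real p * (M / a / real p)"
        using lt p1 a M by (intro add_left_mono mult_right_mono) auto
      also have "\<dots> = (real n * a / real m + M / a) * real m"
        using p1 a m0 by (simp add: field_simps)
      finally have "real p * real m \<le> (real n * a / real m + M / a) * real m"
        by (simp only: mult.commute)
      hence "real p \<le> real n * a / real m + M / a" using m0 by simp
      moreover have "real n * a / real m < real p" using lt m0 by (simp add: field_simps)
      ultimately show "Suc 0 \<le> m \<and> m \<le> Y \<and> p \<in> T m" using mY m0 by (auto simp: T_def)
    qed
  qed
  also have "real (card (Sigma {1..Y} T)) = (\<Sum>m\<in>{1..Y}. real (card (T m)))"
    using finT by (simp add: card_SigmaI)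
  also have "\<dots> \<le> (\<Sum>m\<in>{1..Y}. M / a + 1)" by (intro sum_mono cardT)
  also have "\<dots> = (M / a + 1) * real Y" by simp
  also have "\<dots> \<le> (M / a + 1) * sqrt ((a + M) * real n)"
    using a M by (intro mult_left_mono) (auto simp: Y_def)
  finally show ?thesis by simp
qed

section \<open>Explicit error bound for a fixed \<open>n\<close>\<close>

text \<open>In the last factor of the bound, \<open>N + 2\<close> comes from the primes with
  \<open>p^2 \<le> C * n\<close> and \<open>M / \<alpha> + 1\<close> from the larger ones. The
  exponent \<open>N\<close> stays free here and is later chosen close to
  \<open>log 2 (C * n)\<close>.\<close>

lemma ln_ffact_minus_ln_fact_estimate:
  fixes f :: "real \<Rightarrow> real" and \<alpha> n N :: nat and M :: real
  defines "C \<equiv> real \<alpha> + M"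
  defines "b \<equiv> (\<lambda>p::nat. if prime p then
                 ln (real p) * ((1 / f (real p) - real \<alpha> / real p) * (real p / (real p - 1))) else 0)"
  assumes pos: "\<And>p::nat. prime p \<Longrightarrow> f (real p) > 0"
    and \<alpha>: "\<alpha> > 0" and M: "M \<ge> 0"
    and bd: "\<And>p::nat. prime p \<Longrightarrow>
           0 \<le> 1 / f (real p) - real \<alpha> / real p \<and>
           1 / f (real p) - real \<alpha> / real p \<le> M / (real p)\<^sup>2"
    and n: "n \<ge> 1" and N: "C * real n < 2 ^ N"
  shows "\<bar>ln (ffact f n) - ln (fact (\<alpha> * n)) - real n * (\<Sum>p\<le>nat \<lfloor>sqrt (C * real n)\<rfloor>. b p)\<bar>
           \<le> ln (C * real n) * sqrt (C * real n) * (real N + 2 + (M / real \<alpha> + 1))"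
proof -
  define A where "A = {p. prime p \<and> real p \<le> C * real n}"
  define A1 where "A1 = {p\<in>A. (real p)\<^sup>2 \<le> C * real n}"
  define A2 where "A2 = {p\<in>A. (real p)\<^sup>2 > C * real n}"
  define Y where "Y = nat \<lfloor>sqrt (C * real n)\<rfloor>"
  define x where "x p = real n * (real \<alpha> / real p)" for p :: nat
  define \<delta> where "\<delta> p = 1 / f (real p) - real \<alpha> / real p" for p :: nat
  define F where "F p k = real_of_int \<lfloor>(x p + real n * \<delta> p) / real p ^ k\<rfloor> -
                          real_of_int \<lfloor>x p / real p ^ k\<rfloor>" for p k :: nat
  define L where "L = ln (C * real n)"
  have C: "C \<ge> 1" using \<alpha> M by (simp add: C_def)
  have Cn: "C * real n \<ge> 1" using mult_mono[of 1 C 1 "real n"] C n by simp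
  have L: "L \<ge> 0" using Cn by (simp add: L_def)
  have "A \<subseteq> {..nat \<lfloor>C * real n\<rfloor>}" by (auto simp: le_nat_floor A_def)
  hence fin: "finite A" using finite_subset by blast
  have fin12: "finite A1" "finite A2" using fin by (auto simp: A1_def A2_def)
  have xd: "x p + real n * \<delta> p = real n / f (real p)" for p
    by (simp add: x_def \<delta>_def algebra_simps)
  have \<delta>: "0 \<le> \<delta> p" "\<delta> p \<le> M / (real p)\<^sup>2" if "prime p" for p
    using bd[OF that] by (auto simp: \<delta>_def)
  have gle: "1 / f (real p) \<le> C / real p" if "prime p" for p
  proof -
    have "real p \<ge> 1" using prime_ge_1_nat[OF that] by simp
    hence "M / (real p)\<^sup>2 \<le> M / real p"
      using M by (intro divide_left_mono) (auto simp: power2_eq_square)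
    thus ?thesis using bd[OF that] by (simp add: C_def add_divide_distrib)
  qed
  have lnp: "0 \<le> ln (real p)" "ln (real p) \<le> L" if "p \<in> A" for p
    using that prime_ge_1_nat[of p] by (auto simp: A_def L_def)

  have "ln (fact (\<alpha> * n)) = (\<Sum>p\<in>A. ln (real p) * (\<Sum>k<N. real ((\<alpha> * n) div p ^ Suc k)))"
  proof (rule ln_fact_legendre[OF fin])
    have "real (\<alpha> * n) \<le> C * real n" using M by (simp add: C_def distrib_right)
    moreover from this have "real (\<alpha> * n) < 2 ^ N" using N by linarith
    hence "real (\<alpha> * n) < real (2 ^ N)" by simp
    ultimately show "\<alpha> * n < 2 ^ N" "\<And>p. prime p \<Longrightarrow> p \<le> \<alpha> * n \<Longrightarrow> p \<in> A"
      by (simp_all only: of_nat_less_iff A_def mem_Collect_eq)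
         (metis of_nat_le_iff order_trans)
  qed (auto simp: A_def)
  also have "\<dots> = (\<Sum>p\<in>A. ln (real p) * (\<Sum>k<N. real_of_int \<lfloor>x p / real p ^ k\<rfloor>))"
  proof -
    \<comment> \<open>Index shift: \<open>x p\<close> already contains one division by
      \<open>p\<close>, so the term with \<open>p ^ Suc k\<close> in Legendre's formula pairs with
      the term \<open>k\<close> of the f-exponent.\<close>
    have "real ((\<alpha> * n) div p ^ Suc k) = real_of_int \<lfloor>x p / real p ^ k\<rfloor>" for p k
    proof -
      have "x p / real p ^ k = real (\<alpha> * n) / real (p ^ Suc k)"
        by (simp add: x_def mult.commute)
      thus ?thesis by (simp only: floor_divide_of_nat_eq of_int_of_nat_eq)
    qed
    thus ?thesis by simp
  qed
  finally have D: "ln (ffact f n) - ln (fact (\<alpha> * n)) = (\<Sum>p\<in>A. ln (real p) * (\<Sum>k<N. F p k))"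
    using ln_ffact_eq[OF pos gle N] C
    by (simp add: F_def xd A_def sum_subtractf right_diff_distrib)
  also have "\<dots> = (\<Sum>p\<in>A1. ln (real p) * (\<Sum>k<N. F p k)) + (\<Sum>p\<in>A2. ln (real p) * (\<Sum>k<N. F p k))"
    using fin12 by (subst sum.union_disjoint[symmetric])
      (auto simp: A1_def A2_def intro!: sum.cong)
  finally have D12: "ln (ffact f n) - ln (fact (\<alpha> * n)) =
     (\<Sum>p\<in>A1. ln (real p) * (\<Sum>k<N. F p k)) + (\<Sum>p\<in>A2. ln (real p) * (\<Sum>k<N. F p k))" .

  have A1_eq: "A1 = {p. prime p \<and> p \<le> Y}"
  proof (intro set_eqI iffI)
    fix p assume "p \<in> A1"
    thus "p \<in> {p. prime p \<and> p \<le> Y}"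
      by (auto simp: A1_def A_def Y_def intro!: le_nat_floor real_le_rsqrt)
  next
    fix p assume "p \<in> {p. prime p \<and> p \<le> Y}"
    hence p: "prime p" "p \<le> Y" by auto
    have "real p \<le> sqrt (C * real n)"
      using p(2) Cn by (simp add: Y_def le_nat_iff le_floor_iff)
    hence "(real p)\<^sup>2 \<le> (sqrt (C * real n))\<^sup>2" by (intro power_mono) auto
    hence sq: "(real p)\<^sup>2 \<le> C * real n" using Cn by simp
    have "real p * 1 \<le> real p * real p"
      using prime_ge_1_nat[OF p(1)] by (intro mult_left_mono) auto
    thus "p \<in> A1" using p sq by (auto simp: A1_def A_def power2_eq_square)
  qed
  have "(\<Sum>p\<le>Y. b p) = (\<Sum>p\<in>A1. ln (real p) * (\<delta> p * (real p / (real p - 1))))"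
    unfolding A1_eq by (rule sum.mono_neutral_cong_right) (auto simp: b_def \<delta>_def)
  hence "(\<Sum>p\<in>A1. ln (real p) * (\<Sum>k<N. F p k)) - real n * (\<Sum>p\<le>Y. b p) =
     (\<Sum>p\<in>A1. ln (real p) * ((\<Sum>k<N. F p k) - real n * \<delta> p * (real p / (real p - 1))))"
    by (simp add: sum_distrib_left sum_subtractf right_diff_distrib mult_ac)
  also have "\<bar>\<dots>\<bar> \<le> (\<Sum>p\<in>A1. L * (real N + 2))"
  proof (rule order_trans[OF sum_abs], rule sum_mono)
    fix p assume p: "p \<in> A1"
    hence pA: "p \<in> A" "prime p" by (auto simp: A1_def A_def)
    \<comment> \<open>This crude bound supplies the hypothesis \<open>d \<le> 2 ^ N\<close> of
      \<open>sum_floor_diff_approx\<close> for \<open>d = n * \<delta> p\<close>.\<close>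
    have "\<delta> p \<le> C / real p" 
      unfolding \<delta>_def by (rule order_trans[OF _ gle[OF pA(2)]]) simp
    also have "\<dots> \<le> C / 1" using C prime_ge_1_nat[OF pA(2)] by (intro divide_left_mono) auto
    finally have "real n * \<delta> p \<le> real n * C" by (intro mult_left_mono) auto
    hence "real n * \<delta> p \<le> 2 ^ N" using N by (simp add: mult.commute)
    hence "\<bar>(\<Sum>k<N. F p k) - real n * \<delta> p * (real p / (real p - 1))\<bar> \<le> real N + 2"
      unfolding F_def using \<delta>[OF pA(2)] prime_ge_2_nat[OF pA(2)]
      by (intro sum_floor_diff_approx) auto
    thus "\<bar>ln (real p) * ((\<Sum>k<N. F p k) - real n * \<delta> p * (real p / (real p - 1)))\<bar>
            \<le> L * (real N + 2)"
      using lnp[OF pA(1)] L unfolding abs_mult by (intro mult_mono) auto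
  qed
  also have "\<dots> \<le> sqrt (C * real n) * (L * (real N + 2))"
  proof -
    \<comment> \<open>Counting all integers up to \<open>Y\<close> instead of primes loses only a
      logarithmic factor.\<close>
    have "A1 \<subseteq> {1..Y}" unfolding A1_eq using prime_ge_1_nat by auto
    hence "card A1 \<le> card {1..Y}" by (intro card_mono) auto
    hence "real (card A1) \<le> real Y" by simp
    also have "\<dots> \<le> sqrt (C * real n)" using Cn by (simp add: Y_def)
    finally show ?thesis using L by (simp add: mult_right_mono)
  qed
  finally have E1: "\<bar>(\<Sum>p\<in>A1. ln (real p) * (\<Sum>k<N. F p k)) - real n * (\<Sum>p\<le>Y. b p)\<bar>
                      \<le> sqrt (C * real n) * (L * (real N + 2))" .

  have F_nonneg: "F p k \<ge> 0" if "prime p" for p k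
    unfolding F_def using \<delta>[OF that]
    by (simp add: floor_mono divide_right_mono)
  \<comment> \<open>Since \<open>C * n \<ge> 1 = 2 ^ 0\<close>; this puts the index 0 into the range
    \<open>{..<N}\<close>.\<close>
  have "N \<noteq> 0" using N Cn by (intro notI) simp
  have F_eq: "(\<Sum>k<N. F p k) =
                real_of_int \<lfloor>real n * (1 / f (real p))\<rfloor> - real_of_int \<lfloor>real n * (real \<alpha> / real p)\<rfloor>"
    if "p \<in> A2" for p
  proof -
    have p: "prime p" "C * real n < (real p)\<^sup>2" using that by (auto simp: A2_def A_def)
    have p1: "real p \<ge> 1" using prime_ge_1_nat[OF p(1)] by simp
    \<comment> \<open>For \<open>k \<ge> 1\<close>,
      \<open>n / f p \<le> C * n / p < p \<le> p ^ k\<close>, so both floors vanish.\<close>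
    have z: "F p k = 0" if "k \<in> {..<N} - {0}" for k
    proof -
      have "real n / f (real p) = real n * (1 / f (real p))" by simp
      also have "\<dots> \<le> real n * (C / real p)" using gle[OF p(1)] by (intro mult_left_mono) auto
      also have "\<dots> < real p" using p(2) p1 by (simp add: field_simps power2_eq_square)
      also have "real p ^ 1 \<le> real p ^ k" using that p1 by (intro power_increasing) auto
      hence "real p \<le> real p ^ k" by simp
      finally have lt: "real n / f (real p) / real p ^ k < 1"
        using p1 pos[OF p(1)] by (simp add: field_simps)
      have x0: "0 \<le> x p / real p ^ k" by (simp add: x_def)
      have "x p \<le> x p + real n * \<delta> p" using \<delta>[OF p(1)] by simp
      hence xle: "x p / real p ^ k \<le> real n / f (real p) / real p ^ k"
        unfolding xd by (intro divide_right_mono) auto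
      have "\<lfloor>real n / f (real p) / real p ^ k\<rfloor> = 0" "\<lfloor>x p / real p ^ k\<rfloor> = 0"
        using lt x0 xle by (auto simp: floor_eq_iff)
      thus ?thesis unfolding F_def xd by simp
    qed
    have "(\<Sum>k<N. F p k) = (\<Sum>k\<in>{0}. F p k)"
      using z \<open>N \<noteq> 0\<close> by (intro sum.mono_neutral_right) auto
    thus ?thesis by (simp add: F_def xd) (simp add: x_def)
  qed
  have "(\<Sum>p\<in>A2. ln (real p) * (\<Sum>k<N. F p k)) \<le> (\<Sum>p\<in>A2. L * (\<Sum>k<N. F p k))"
    using lnp F_nonneg
    by (intro sum_mono mult_right_mono sum_nonneg) (auto simp: A2_def A_def)
  also have "\<dots> = L * (\<Sum>p\<in>A2. real_of_int \<lfloor>real n * (1 / f (real p))\<rfloor> -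
                             real_of_int \<lfloor>real n * (real \<alpha> / real p)\<rfloor>)"
    by (simp add: sum_distrib_left F_eq cong: sum.cong)
  also have "\<dots> \<le> L * ((M / real \<alpha> + 1) * sqrt ((real \<alpha> + M) * real n))"
  proof (intro mult_left_mono L sum_floor_diff_large_le)
    fix p assume "p \<in> A2"
    hence p: "prime p" "C * real n < (real p)\<^sup>2" by (auto simp: A2_def A_def)
    show "1 \<le> p \<and> (real \<alpha> + M) * real n < (real p)\<^sup>2"
      using p prime_ge_1_nat by (auto simp: C_def)
    show "real \<alpha> / real p \<le> 1 / f (real p) \<and> 1 / f (real p) \<le> real \<alpha> / real p + M / (real p)\<^sup>2"
      using bd[OF p(1)] by linarith
  qed (use fin12 \<alpha> M in auto)
  finally have E2: "(\<Sum>p\<in>A2. ln (real p) * (\<Sum>k<N. F p k)) \<le>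
                      L * ((M / real \<alpha> + 1) * sqrt (C * real n))" by (simp add: C_def)
  \<comment> \<open>Together with \<open>E2\<close> this bounds the absolute value of the
    contribution of the large primes.\<close>
  have E2': "(\<Sum>p\<in>A2. ln (real p) * (\<Sum>k<N. F p k)) \<ge> 0"
    using lnp F_nonneg by (intro sum_nonneg mult_nonneg_nonneg) (auto simp: A2_def A_def)
  have "L * sqrt (C * real n) * (real N + 2 + (M / real \<alpha> + 1)) =
     sqrt (C * real n) * (L * (real N + 2)) + L * ((M / real \<alpha> + 1) * sqrt (C * real n))"
    by (simp only: distrib_left distrib_right mult_ac)
  thus ?thesis
    using E1 E2 E2' D12 unfolding L_def Y_def by linarith
qed

section \<open>Convergence of the constant and passage to the limit\<close>

theorem theorem13:
  fixes f :: "real \<Rightarrow> real" and \<alpha> :: nat and M :: real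
  assumes "\<And>p::nat. prime p \<Longrightarrow> f (real p) > 0"
    and "\<alpha> > 0" and "M \<ge> 0"
    and "\<And>p::nat. prime p \<Longrightarrow>
           0 \<le> 1 / f (real p) - real \<alpha> / real p \<and>
           1 / f (real p) - real \<alpha> / real p \<le> M / (real p)\<^sup>2"
  shows "\<exists>\<beta>\<ge>0. (\<lambda>n. ln (ffact f n) - (ln (fact (\<alpha> * n)) + \<beta> * real n)) \<in> o(\<lambda>n. real n)"
proof -
  define C where "C = real \<alpha> + M"
  define b where "b = (\<lambda>p::nat. if prime p then
      ln (real p) * ((1 / f (real p) - real \<alpha> / real p) * (real p / (real p - 1))) else 0)"
  define \<beta> where "\<beta> = suminf b"
  define Y where "Y n = nat \<lfloor>sqrt (C * real n)\<rfloor>" for n :: nat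
  \<comment> \<open>The added 1 makes \<open>C * n < 2 ^ N n\<close> strict.\<close>
  define N where "N n = nat \<lceil>log 2 (C * real n)\<rceil> + 1" for n :: nat
  \<comment> \<open>The error bound with \<open>N n \<le> log 2 (C * n) + 2\<close> inserted, whence
    the constant \<open>4 = 2 + 2\<close>.\<close>
  define G where "G = (\<lambda>x::real. ln (C * x) * sqrt (C * x) * (log 2 (C * x) + 4 + (M / real \<alpha> + 1)))"
  have C: "C \<ge> 1" using assms(2,3) by (simp add: C_def)
  have b_nonneg: "b p \<ge> 0" for p
    using assms(4)[of p] prime_ge_1_nat[of p] by (auto simp: b_def)
  \<comment> \<open>The factor 2 bounds \<open>p / (p - 1)\<close> at primes.\<close>
  have b_le: "b p \<le> 2 * M * (ln (real p) / (real p)\<^sup>2)" for p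
  proof (cases "prime p")
    case True
    have p: "real p \<ge> 2" using prime_ge_2_nat[OF True] by simp
    hence "(1 / f (real p) - real \<alpha> / real p) * (real p / (real p - 1)) \<le> M / (real p)\<^sup>2 * 2"
      using assms(3) assms(4)[OF True] by (intro mult_mono) (auto simp: field_simps)
    hence "ln (real p) * ((1 / f (real p) - real \<alpha> / real p) * (real p / (real p - 1))) \<le>
           ln (real p) * (M / (real p)\<^sup>2 * 2)"
      using p by (intro mult_left_mono) auto
    thus ?thesis using True by (simp add: b_def mult_ac)
  next
    case False
    \<comment> \<open>The case \<open>p = 0\<close> rests on the convention
      \<open>ln 0 = 0\<close>.\<close>
    have "0 \<le> ln (real p)" by (cases "p = 0") auto
    thus ?thesis using False assms(3) by (simp add: b_def)
  qed
  have summ: "summable b"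
  proof (rule summable_comparison_test')
    show "summable (\<lambda>p. 2 * M * (ln (real p) / (real p)\<^sup>2))"
      by (intro summable_mult summable_ln_over_square)
    show "norm (b p) \<le> 2 * M * (ln (real p) / (real p)\<^sup>2)" if "p \<ge> 0" for p
      using b_nonneg[of p] b_le[of p] by simp
  qed
  have "filterlim (\<lambda>n. nat \<lfloor>sqrt (C * real n)\<rfloor>) at_top at_top"
    using C by real_asymp
  moreover have "(\<lambda>k. \<Sum>p\<le>k. b p) \<longlonglongrightarrow> \<beta>"
    using summable_LIMSEQ'[OF summ] by (simp add: \<beta>_def)
  ultimately have "(\<lambda>n. \<Sum>p\<le>Y n. b p) \<longlonglongrightarrow> \<beta>"
    unfolding Y_def by (rule filterlim_compose[rotated])
  hence tail: "(\<lambda>n. \<bar>(\<Sum>p\<le>Y n. b p) - \<beta>\<bar>) \<longlonglongrightarrow> 0"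
    using LIM_zero tendsto_rabs_zero by blast
  \<comment> \<open>\<open>G x\<close> has order \<open>sqrt x * (ln x)^2\<close>.\<close>
  have "((\<lambda>x. G x / x) \<longlongrightarrow> 0) at_top"
    unfolding G_def using C by real_asymp
  hence G: "(\<lambda>n. G (real n) / real n) \<longlonglongrightarrow> 0"
    by (rule filterlim_compose[OF _ filterlim_real_sequentially])
  have est: "\<bar>ln (ffact f n) - ln (fact (\<alpha> * n)) - real n * (\<Sum>p\<le>Y n. b p)\<bar> \<le> G (real n)"
    if n: "n \<ge> 1" for n
  proof -
    have Cn: "C * real n \<ge> 1" using mult_mono[of 1 C 1 "real n"] C n by simp
    have "C * real n = 2 powr log 2 (C * real n)" using Cn by simp
    also have "\<dots> < 2 powr real (N n)"
      unfolding N_def by (intro powr_less_mono) linarith+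
    finally have "C * real n < 2 ^ N n" by (simp add: powr_realpow)
    hence "\<bar>ln (ffact f n) - ln (fact (\<alpha> * n)) - real n * (\<Sum>p\<le>Y n. b p)\<bar> \<le>
            ln (C * real n) * sqrt (C * real n) * (real (N n) + 2 + (M / real \<alpha> + 1))"
      unfolding b_def Y_def C_def
      by (intro ln_ffact_minus_ln_fact_estimate[OF assms n]) auto
    also have "real (N n) \<le> log 2 (C * real n) + 2"
      using Cn zero_le_log_cancel_iff[of 2 "C * real n"] unfolding N_def by linarith
    hence "ln (C * real n) * sqrt (C * real n) * (real (N n) + 2 + (M / real \<alpha> + 1)) \<le> G (real n)"
      unfolding G_def using Cn by (intro mult_left_mono) auto
    finally show ?thesis .
  qed
  have "(\<lambda>n. (ln (ffact f n) - (ln (fact (\<alpha> * n)) + \<beta> * real n)) / real n) \<longlonglongrightarrow> 0"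
  proof (rule Lim_null_comparison)
    show "(\<lambda>n. G (real n) / real n + \<bar>(\<Sum>p\<le>Y n. b p) - \<beta>\<bar>) \<longlonglongrightarrow> 0"
      using tendsto_add[OF G tail] by simp
    show "\<forall>\<^sub>F n in sequentially.
        norm ((ln (ffact f n) - (ln (fact (\<alpha> * n)) + \<beta> * real n)) / real n)
          \<le> G (real n) / real n + \<bar>(\<Sum>p\<le>Y n. b p) - \<beta>\<bar>"
      using eventually_ge_at_top[of 1]
    proof eventually_elim
      case (elim n)
      \<comment> \<open>The error splits into the floor error, bounded by \<open>G n\<close>, and
        \<open>n\<close> times the tail of the series for \<open>\<beta>\<close> beyond
        \<open>Y n\<close>.\<close>
      have "ln (ffact f n) - (ln (fact (\<alpha> * n)) + \<beta> * real n) =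
             (ln (ffact f n) - ln (fact (\<alpha> * n)) - real n * (\<Sum>p\<le>Y n. b p)) +
             real n * ((\<Sum>p\<le>Y n. b p) - \<beta>)" by (simp add: algebra_simps)
      hence "\<bar>ln (ffact f n) - (ln (fact (\<alpha> * n)) + \<beta> * real n)\<bar> \<le>
             G (real n) + real n * \<bar>(\<Sum>p\<le>Y n. b p) - \<beta>\<bar>"
        using est[OF elim] abs_mult[of "real n" "(\<Sum>p\<le>Y n. b p) - \<beta>"] by simp
      thus ?case using elim by (simp add: field_simps)
    qed
  qed
  hence "(\<lambda>n. ln (ffact f n) - (ln (fact (\<alpha> * n)) + \<beta> * real n)) \<in> o(\<lambda>n. real n)"
    by (rule smalloI_tendsto) (use eventually_gt_at_top[of "0::nat"] in eventually_elim, simp)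
  moreover have "\<beta> \<ge> 0"
    unfolding \<beta>_def by (rule suminf_nonneg[OF summ b_nonneg])
  ultimately show ?thesis by blast
qed

end
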